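(* Let $m\geq 1$ be an integer and let $a,b\in\mathbb{F}_{2^m}^{\ast}$ satisfy $\mathrm{Tr}_m\left((ab)^{-1}\right)=\mathrm{Tr}_m(1)$. Then the polynomial $$f(x)=b^2(x+a)^3+x\in\mathbb{F}_{2^m}[x]$$ is stable over $\mathbb{F}_{2^m}$ if and only if it is irreducible over $\mathbb{F}_{2^m}$.
   Context: $\mathrm{Tr}_m:\mathbb{F}_{2^m}\to\mathbb{F}_2$ is the absolute trace, $\mathrm{Tr}_m(x)=\sum_{j=0}^{m-1}x^{2^j}$. For a field $K$, a polynomial $t(x)\in K[x]$ is called stable over $K$ if for every integer $n\ge 1$ the $n$-th iterate $t^{(n)}(x)=t(t(\cdots t(x)\cdots))$ ($n$-fold composition) is irreducible over $K$. *)

theory Defs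
  imports "HOL-Computational_Algebra.Computational_Algebra"
begin

(* The n-fold composition of t with itself; the 0-th iterate is the polynomial x. *)
definition poly_iterate :: "nat \<Rightarrow> 'a::comm_semiring_1 poly \<Rightarrow> 'a poly" where
  "poly_iterate n t = (pcompose t ^^ n) [:0, 1:]"

(* Irreducibility over K is irreducibility in the ring of polynomials over the type 'a = K. *)
definition stable_poly :: "'a::field poly \<Rightarrow> bool" where
  "stable_poly t \<longleftrightarrow> (\<forall>n\<ge>1. irreducible (poly_iterate n t))"

(* On the field with 2^m elements this is the absolute trace; its values are kept in that field,
   where they lie in the prime subfield {0, 1}. *)
definition Tr :: "nat \<Rightarrow> 'a::field \<Rightarrow> 'a" where
  "Tr m x = (\<Sum>j<m. x ^ (2 ^ j))"

end

theory Submission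
  imports "HOL-Algebra.Algebraic_Closure_Type" Defs
begin

text \<open>
  The substitution \<open>z = b (x + a)\<close> conjugates \<open>f\<close> to \<open>z\<^sup>3 + z\<close>, which in characteristic 2 is the
  Dickson polynomial sending \<open>u + 1/u\<close> to \<open>u\<^sup>3 + 1/u\<^sup>3\<close>. So the roots of the \<open>n\<close>-th iterate
  correspond to \<open>u + 1/u\<close> with \<open>u^(3^n) = \<beta>\<close> and \<open>\<beta> + 1/\<beta> = a b\<close>. Let \<open>q = 2^m\<close>. The trace condition
  puts \<open>\<beta>\<close> into the subgroup of order \<open>q - 1\<close> or \<open>q + 1\<close> whose order is divisible by 3, and
  irreducibility of \<open>f\<close> then says that \<open>\<beta>\<close> is not a cube there. If a root of a factor \<open>A\<close> of
  the iterate is fixed by the \<open>q^j\<close>-Frobenius map, where we may take \<open>0 < j \<le> deg A\<close>, then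
  \<open>u^(q^(2j)) = u\<close>, while \<open>u^(q^2 - 1)\<close> has order exactly \<open>3^n\<close>. Lifting the exponent
  gives \<open>3^n dvd j\<close>, so \<open>A\<close> has full degree.
\<close>

section \<open>Lifting the exponent at 3 and multiplicative orders\<close>

text \<open>Every term is 1 modulo 3, so 3 divides \<open>j\<close>. With \<open>j = 3 * k\<close>
  the sum splits off \<open>1 + Y + Y ^ 2\<close>, which contains exactly one factor 3; the cofactor
  is the same kind of sum for \<open>Y ^ 3\<close> and \<open>k\<close>.\<close>

lemma three_power_dvd_geometric_sum:
  fixes Y :: nat
  assumes "Y mod 3 = 1" "3 ^ n dvd (\<Sum>i<j. Y ^ i)"
  shows "3 ^ n dvd j"
  using assms
proof (induction n arbitrary: Y j)
  case (Suc n)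
  have "(\<Sum>i<j. Y ^ i) mod 3 = (\<Sum>i<j. Y ^ i mod 3) mod 3"
    by (simp add: mod_sum_eq)
  also have "\<dots> = (\<Sum>i<j. 1) mod 3"
  proof -
    have "Y ^ i mod 3 = 1" for i
      using power_mod[of Y 3 i] Suc.prems(1) by simp
    then show ?thesis by simp
  qed
  finally have "(\<Sum>i<j. Y ^ i) mod 3 = j mod 3" by simp
  moreover have "3 dvd (\<Sum>i<j. Y ^ i)"
    using Suc.prems(2) by (meson dvd_power dvd_trans zero_less_Suc)
  ultimately obtain k where j: "j = 3 * k" by (auto simp: dvd_eq_mod_eq_0 elim: dvdE)
  have "(\<Sum>i<3 * k. Y ^ i) = (1 + Y + Y ^ 2) * (\<Sum>i<k. (Y ^ 3) ^ i)"
  proof (induction k)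
    case (Suc k)
    have "3 * Suc k = Suc (Suc (Suc (3 * k)))" by simp
    then show ?case
      using Suc by (simp only: sum.lessThan_Suc power_mult power_Suc)
        (simp add: algebra_simps power2_eq_square)
  qed simp
  moreover obtain t where t: "Y = 3 * t + 1"
    using Suc.prems(1) by (metis mult_div_mod_eq)
  have "1 + Y + Y ^ 2 = 3 * (1 + 3 * (t + t ^ 2))"
    unfolding t by (simp add: power2_eq_square algebra_simps)
  ultimately have "3 ^ n dvd (1 + 3 * (t + t ^ 2)) * (\<Sum>i<k. (Y ^ 3) ^ i)"
    using Suc.prems(2) by (simp only: j mult.assoc power_Suc nat_mult_dvd_cancel_disj) simp
  moreover have "coprime (3 ^ n) (1 + 3 * (t + t ^ 2))"
  proof -
    have "coprime 3 (1 + 3 * z)" for z :: nat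
      by (rule coprimeI) (metis dvd_add_left_iff dvd_mult2)
    then show ?thesis by (simp only: coprime_power_left_iff simp_thms)
  qed
  ultimately have "3 ^ n dvd (\<Sum>i<k. (Y ^ 3) ^ i)"
    by (metis coprime_dvd_mult_right_iff)
  moreover have "Y ^ 3 mod 3 = 1"
    by (metis Suc.prems(1) power_mod power_one mod_less one_less_numeral_iff semiring_norm(77))
  ultimately have "3 ^ n dvd k" using Suc.IH by blast
  then show ?case unfolding j by simp
qed simp

text \<open>The last two hypotheses say that \<open>y\<close> has order exactly
  \<open>p ^ Suc n\<close>. Bezout turns the exponents \<open>F\<close> and \<open>p ^ Suc n\<close>
  into their gcd, which therefore cannot be a smaller power of \<open>p\<close>.\<close>

lemma prime_power_dvd_exponent:
  fixes y :: "'a::field" and p :: nat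
  assumes "prime p" "y ^ F = 1" "y ^ (p ^ Suc n) = 1" "y ^ (p ^ n) \<noteq> 1"
  shows "p ^ Suc n dvd F"
proof (cases "F = 0")
  case False
  define g where "g = gcd F (p ^ Suc n)"
  have "g dvd p ^ Suc n" by (simp add: g_def)
  then obtain i where i: "i \<le> Suc n" "g = p ^ i"
    using divides_primepow_nat[OF assms(1)] by blast
  obtain s t where "F * s = p ^ Suc n * t + g"
    using bezout_nat[OF False, of "p ^ Suc n"] by (auto simp: g_def)
  then have "(y ^ F) ^ s = (y ^ (p ^ Suc n)) ^ t * y ^ g"
    by (simp flip: power_mult power_add)
  then have yg: "y ^ g = 1" unfolding assms by simp
  have "i = Suc n"
  proof (rule ccontr)
    assume "i \<noteq> Suc n"
    then have "p ^ n = g * p ^ (n - i)" using i by (simp flip: power_add)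
    then show False using yg assms(4) by (simp add: power_mult)
  qed
  then show ?thesis using i by (metis g_def gcd_dvd1)
qed simp

lemma Suc_power_eq_geometric_sum: "Suc d ^ j = Suc (d * (\<Sum>i<j. Suc d ^ i))"
  by (induction j) (auto simp: algebra_simps)

text \<open>The element \<open>y = u ^ (Y - 1)\<close> has order exactly \<open>3 ^ n\<close>, and
  \<open>u ^ (Y ^ j) = u\<close> says that the geometric sum
  \<open>F = (Y ^ j - 1) / (Y - 1)\<close> kills \<open>y\<close>.\<close>

lemma three_power_dvd_frobenius_period:
  fixes u :: "'a::field"
  assumes Y: "Y mod 3 = 1" and u: "u \<noteq> 0" "u ^ (Y ^ j) = u"
    and \<beta>: "(u ^ 3 ^ n) ^ (Y - 1) = 1" "(u ^ 3 ^ n) ^ ((Y - 1) div 3) \<noteq> 1"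
  shows "3 ^ n dvd j"
proof (cases n)
  case (Suc k)
  define d where "d = Y - 1"
  have Yd: "Y = Suc d" using Y by (cases Y) (auto simp: d_def)
  define y where "y = u ^ d"
  define F where "F = (\<Sum>i<j. Y ^ i)"
  have "Y ^ j = Suc (d * F)"
    unfolding F_def Yd by (rule Suc_power_eq_geometric_sum)
  then have yF: "y ^ F = 1"
    using u by (simp add: y_def power_mult)
  have y1: "y ^ 3 ^ Suc k = 1"
    using \<beta>(1) by (simp add: y_def d_def Suc power_mult[symmetric] mult.commute)
  \<comment> \<open>A factor 3 moves out of \<open>d\<close>: \<open>y ^ 3 ^ k\<close> is
    \<open>u ^ 3 ^ n\<close> raised to \<open>d div 3\<close>.\<close>
  have y2: "y ^ 3 ^ k \<noteq> 1"
  proof -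
    have "d = 3 * (d div 3)" using Y Yd by presburger
    then have "d * 3 ^ k = 3 ^ n * (d div 3)" by (simp add: Suc)
    then show ?thesis using \<beta>(2) by (metis d_def power_mult y_def)
  qed
  have "3 ^ n dvd F"
    unfolding Suc by (rule prime_power_dvd_exponent[OF _ yF y1 y2]) simp
  then show ?thesis
    unfolding F_def by (rule three_power_dvd_geometric_sum[OF Y])
qed simp

section \<open>Characteristic 2: the Dickson polynomial and the trace\<close>

lemma add_power_two_power:
  fixes x y :: "'a::comm_ring_1"
  assumes "(2::'a) = 0"
  shows "(x + y) ^ 2 ^ k = x ^ 2 ^ k + y ^ 2 ^ k"
proof (induction k)
  case (Suc k)
  have sq: "z ^ 2 ^ Suc k = (z ^ 2 ^ k)\<^sup>2" for z :: 'a
    by (simp only: power_Suc2 power_mult)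
  show ?case
    unfolding sq Suc by (simp add: power2_sum assms)
qed simp

text \<open>The cross term \<open>3 * (v * w) * (v + w)\<close> and the extra \<open>v + w\<close>
  add up to \<open>4 * (v + w)\<close>, which vanishes.\<close>

lemma cube_add_self_of_sum_inverse:
  fixes v w :: "'a::comm_ring_1"
  assumes "(2::'a) = 0" "v * w = 1"
  shows "(v + w) ^ 3 + (v + w) = v ^ 3 + w ^ 3"
proof -
  have "(v + w) ^ 3 + (v + w) = v ^ 3 + w ^ 3 + 3 * (v * w) * (v + w) + (v + w)"
    by (simp add: algebra_simps power3_eq_cube)
  also have "\<dots> = v ^ 3 + w ^ 3 + 2 * (2 * (v + w))"
    by (simp add: assms(2) algebra_simps)
  finally show ?thesis by (simp add: assms(1))
qed

lemma funpow_cube_add_self_of_sum_inverse: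
  fixes v w :: "'a::comm_ring_1"
  assumes "(2::'a) = 0" "v * w = 1"
  shows "((\<lambda>z. z ^ 3 + z) ^^ n) (v + w) = v ^ 3 ^ n + w ^ 3 ^ n"
proof (induction n)
  case (Suc n)
  have "v ^ 3 ^ n * w ^ 3 ^ n = 1"
    by (metis assms(2) power_mult_distrib power_one)
  then show ?case
    by (simp add: Suc cube_add_self_of_sum_inverse[OF assms(1)] mult.commute flip: power_mult)
qed simp

text \<open>Both pairs consist of the roots of one quadratic with constant term 1.\<close>

lemma sum_inverse_eqD:
  fixes u w u' w' :: "'a::field"
  assumes "u * w = 1" "u' * w' = 1" "u + w = u' + w'"
  shows "u' = u \<or> u' = w"
proof -
  have "(u' - u) * (u' - w) = u' * u' - u' * (u + w) + u * w" by (simp add: algebra_simps)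
  also have "\<dots> = 0" unfolding assms(3) by (simp add: assms algebra_simps)
  finally show ?thesis by simp
qed

lemma sum_inverse_exists:
  fixes c :: "'a::alg_closed_field"
  obtains u w where "u * w = 1" "u + w = c"
proof -
  obtain u where "poly [:1, -c, 1:] u = 0"
    using alg_closed_imp_poly_has_root[of "[:1, -c, 1:]"] by auto
  then have "u * (c - u) = 1" by (simp add: algebra_simps)
  then show ?thesis using that[of u "c - u"] by simp
qed

lemma Tr_square_add_self:
  fixes x :: "'a::field"
  assumes "(2::'a) = 0"
  shows "Tr m (x\<^sup>2 + x) = x ^ 2 ^ m + x"
proof -
  have dbl: "y + y + z = z" for y z :: 'a using assms by (simp flip: mult_2)
  show ?thesis
  proof (induction m)
    case 0
    then show ?case using dbl[of x 0] by (simp add: Tr_def)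
  next
    case (Suc m)
    have "Tr (Suc m) (x\<^sup>2 + x) = Tr m (x\<^sup>2 + x) + (x ^ 2 ^ Suc m + x ^ 2 ^ m)"
      by (simp add: Tr_def add_power_two_power[OF assms] flip: power_mult)
    also have "\<dots> = x ^ 2 ^ m + x ^ 2 ^ m + (x ^ 2 ^ Suc m + x)"
      unfolding Suc by (simp only: ac_simps)
    finally show ?case by (simp only: dbl)
  qed
qed

lemma Tr_square:
  fixes x :: "'a::field"
  assumes "(2::'a) = 0"
  shows "Tr m (x\<^sup>2) = (Tr m x)\<^sup>2"
proof (induction m)
  case (Suc m)
  have "Tr (Suc m) x = Tr m x + x ^ 2 ^ m" for x :: 'a by (simp add: Tr_def)
  with Suc show ?case
    by (simp add: power2_sum assms mult.commute flip: power_mult)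
qed (simp add: Tr_def)

lemma Tr_one:
  assumes "(2::'a::field) = 0"
  shows "Tr m (1::'a) = (if even m then 0 else 1)"
  using assms by (auto simp: Tr_def elim!: evenE oddE)

lemma two_power_mod_three: "(2::nat) ^ m mod 3 = (if even m then 1 else 2)"
proof (induction m)
  case (Suc m)
  have "(2::nat) ^ Suc m mod 3 = 2 * (2 ^ m mod 3) mod 3"
    by (simp add: mod_mult_right_eq)
  with Suc show ?case by simp
qed simp

text \<open>
  With \<open>\<beta> = c \<gamma>\<close>, the equation \<open>\<beta> + 1/\<beta> = c\<close> becomes \<open>\<gamma>\<^sup>2 + \<gamma> = 1/c\<^sup>2\<close>, so the trace of
  \<open>1/c\<close> decides whether the Frobenius map fixes \<open>\<beta>\<close> or inverts it.
\<close>
lemma frobenius_sum_inverse: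
  fixes \<beta> w c :: "'a::field"
  assumes two: "(2::'a) = 0" and c: "c \<noteq> 0" "c ^ 2 ^ m = c"
    and tr: "Tr m (inverse c) = Tr m 1"
    and \<beta>: "\<beta> * w = 1" "\<beta> + w = c"
  shows "\<beta> ^ 2 ^ m = (if even m then \<beta> else w)"
proof -
  have dbl: "x + x = 0" for x :: 'a using two by (simp flip: mult_2)
  define \<gamma> where "\<gamma> = \<beta> / c"
  have "\<beta>\<^sup>2 + c * \<beta> = (\<beta>\<^sup>2 + \<beta>\<^sup>2) + \<beta> * w"
    unfolding \<beta>(2)[symmetric] by (simp add: algebra_simps power2_eq_square)
  also have "\<dots> = 1" by (simp add: dbl \<beta>)
  finally have "\<gamma>\<^sup>2 + \<gamma> = (inverse c)\<^sup>2"
    using c by (simp add: \<gamma>_def field_simps power2_eq_square)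
  then have "\<gamma> ^ 2 ^ m + \<gamma> = (if even m then 0 else 1)"
    using Tr_square_add_self[OF two, of m \<gamma>]
    by (simp add: Tr_square[OF two] tr Tr_one[OF two] split: if_splits)
  moreover have "\<gamma> ^ 2 ^ m = (\<gamma> ^ 2 ^ m + \<gamma>) + \<gamma>"
    by (simp add: add.assoc dbl)
  ultimately have "\<gamma> ^ 2 ^ m = (if even m then \<gamma> else 1 + \<gamma>)"
    by simp
  moreover have "\<beta> ^ 2 ^ m = c * \<gamma> ^ 2 ^ m"
    using c by (simp add: \<gamma>_def power_divide)
  moreover have "c + \<beta> = w"
    unfolding \<beta>(2)[symmetric] using dbl[of \<beta>] by (simp add: ac_simps flip: add.assoc)
  ultimately show ?thesis
    using c by (simp add: \<gamma>_def distrib_left)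
qed

section \<open>Cubes in the subgroup containing \<open>\<beta>\<close>, and periods of iterate
  roots\<close>

text \<open>If the second power were 1, \<open>\<beta>\<close> would have a cube root
  \<open>v\<close> that the \<open>q\<close>-Frobenius fixes or inverts. Then
  \<open>v + inverse v\<close> is a Frobenius-fixed root of \<open>z ^ 3 + z = c\<close>.\<close>

lemma not_cube_if_no_root:
  fixes \<beta> w c :: "'a::alg_closed_field"
  assumes two: "(2::'a) = 0" and q: "q = 2 ^ m" and c: "c \<noteq> 0" "c ^ q = c"
    and tr: "Tr m (inverse c) = Tr m 1"
    and \<beta>: "\<beta> * w = 1" "\<beta> + w = c"
    and no_root: "\<And>z. z ^ q = z \<Longrightarrow> z ^ 3 + z \<noteq> c"
  shows "\<beta> ^ (q\<^sup>2 - 1) = 1" "\<beta> ^ ((q\<^sup>2 - 1) div 3) \<noteq> 1"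
proof -
  have q0: "q > 0" by (simp add: q)
  have sq: "q\<^sup>2 - 1 = (q - 1) * (q + 1)"
    by (simp add: power2_eq_square algebra_simps)
  have fr: "\<beta> ^ q = (if even m then \<beta> else w)"
    using frobenius_sum_inverse[OF two c(1) _ tr \<beta>] c q by simp
  have \<beta>0: "\<beta> \<noteq> 0" using \<beta> by auto
  \<comment> \<open>\<open>R\<close> is the order of the subgroup containing \<open>\<beta>\<close>;
    the parity of \<open>m\<close> makes 3 divide it and not the cofactor \<open>R'\<close>.\<close>
  define R where "R = (if even m then q - 1 else q + 1)"
  define R' where "R' = (if even m then q + 1 else q - 1)"
  have RR: "q\<^sup>2 - 1 = R * R'" unfolding sq R_def R'_def by (cases "even m") simp_all
  have qm: "q mod 3 = (if even m then 1 else 2)" using two_power_mod_three q by simp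
  have R3: "3 dvd R" "\<not> 3 dvd R'"
    using qm q0 by (auto simp: R_def R'_def split: if_splits; presburger)+
  have \<beta>R: "\<beta> ^ R = 1"
    using fr \<beta> \<beta>0 q0 by (auto simp: R_def power_diff)
  then show "\<beta> ^ (q\<^sup>2 - 1) = 1" unfolding RR power_mult by simp
  show "\<beta> ^ ((q\<^sup>2 - 1) div 3) \<noteq> 1"
  proof
    assume *: "\<beta> ^ ((q\<^sup>2 - 1) div 3) = 1"
    define \<delta> where "\<delta> = \<beta> ^ (R div 3)"
    have d3: "\<delta> ^ 3 = 1" using \<beta>R R3(1) by (simp add: \<delta>_def flip: power_mult)
    have "(q\<^sup>2 - 1) div 3 = R div 3 * R'"
      unfolding RR using R3(1) by (metis dvd_div_mult)
    then have dR: "\<delta> ^ R' = 1"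
      using * by (metis \<delta>_def power_mult)
    \<comment> \<open>A nontrivial \<open>\<delta>\<close> would have order 3, forcing 3 to divide
      \<open>R'\<close>.\<close>
    have "\<delta> = 1"
      using prime_power_dvd_exponent[of 3 \<delta> R' 0] d3 dR R3(2) by auto
    \<comment> \<open>Any cube root in the closure will do, since \<open>v ^ R\<close> equals
      \<open>\<beta> ^ (R div 3)\<close>.\<close>
    obtain v where v: "v ^ 3 = \<beta>" using nth_root_exists[of 3 \<beta>] by auto
    have v0: "v \<noteq> 0" using v \<beta>0 by auto
    have vR: "v ^ R = 1"
      using \<open>\<delta> = 1\<close> R3(1) v by (metis \<delta>_def dvd_mult_div_cancel power_mult)
    have "(v + inverse v) ^ q = v ^ q + inverse (v ^ q)"
      using add_power_two_power[OF two] by (simp add: q power_inverse)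
    also have "\<dots> = v + inverse v"
    proof (cases "even m")
      case True
      then have "v ^ q = v" using vR v0 q0 by (simp add: R_def power_diff)
      then show ?thesis by simp
    next
      case False
      then have "v * v ^ q = 1" using vR by (simp add: R_def)
      then have "v ^ q = inverse v" using v0 by (metis inverse_unique)
      then show ?thesis by simp
    qed
    finally have "(v + inverse v) ^ q = v + inverse v" .
    moreover have "(v + inverse v) ^ 3 + (v + inverse v) = c"
    proof -
      have "w = inverse \<beta>" using \<beta>(1) by (metis inverse_unique)
      then show ?thesis
        using cube_add_self_of_sum_inverse[OF two, of v "inverse v"] v0 v \<beta>(2)
        by (simp add: power_inverse)
    qed
    ultimately show False using no_root by blast
  qed
qed

lemma three_power_dvd_period_of_iterate_root:
  fixes \<theta> c :: "'a::alg_closed_field"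
  assumes two: "(2::'a) = 0" and q: "q = 2 ^ m" and c: "c \<noteq> 0" "c ^ q = c"
    and tr: "Tr m (inverse c) = Tr m 1"
    and no_root: "\<And>z. z ^ q = z \<Longrightarrow> z ^ 3 + z \<noteq> c"
    and \<theta>: "((\<lambda>z. z ^ 3 + z) ^^ n) \<theta> = c" "\<theta> ^ (q ^ j) = \<theta>"
  shows "3 ^ n dvd j"
proof -
  obtain u w where u: "u * w = 1" "u + w = \<theta>" by (rule sum_inverse_exists)
  have u0: "u \<noteq> 0" using u by auto
  have w: "w = inverse u" using u(1) by (metis inverse_unique)
  have \<beta>: "u ^ 3 ^ n * w ^ 3 ^ n = 1" "u ^ 3 ^ n + w ^ 3 ^ n = c"
    using funpow_cube_add_self_of_sum_inverse[OF two u(1)] \<theta>(1)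
    by (metis u(1) power_mult_distrib power_one, metis u(2))
  note nc = not_cube_if_no_root[OF two q c tr \<beta> no_root]
  define Q where "Q = q ^ j"
  have "u ^ Q + w ^ Q = (u + w) ^ Q"
    using add_power_two_power[OF two] by (simp add: Q_def q flip: power_mult)
  then have "u ^ Q + w ^ Q = u + w" using \<theta>(2) u by (simp add: Q_def)
  moreover have "u ^ Q * w ^ Q = 1" using u0 by (simp add: w power_inverse)
  ultimately have "u ^ Q = u \<or> u ^ Q = inverse u"
    using sum_inverse_eqD[of u w "u ^ Q" "w ^ Q"] u w by simp
  \<comment> \<open>Applying the map twice removes the possible inversion, which is why the period
    is measured with \<open>q\<^sup>2\<close> in place of \<open>q\<close>.\<close>
  then have "(u ^ Q) ^ Q = u" by (auto simp: power_inverse)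
  then have "u ^ ((q\<^sup>2) ^ j) = u"
    by (simp add: Q_def flip: power_mult power_add) (simp add: mult_2 mult_2_right mult.commute)
  moreover have "q\<^sup>2 mod 3 = 1"
    using two_power_mod_three[of "2 * m"] by (simp add: q mult.commute flip: power_mult)
  ultimately show ?thesis
    using three_power_dvd_frobenius_period[of "q\<^sup>2" u j n] u0 nc by simp
qed

section \<open>Finite fields inside their algebraic closure\<close>

text \<open>Multiplication by a nonzero \<open>x\<close> permutes the nonzero elements, so their
  product can be cancelled.\<close>

lemma finite_type_power_card:
  fixes x :: "'a::{field, finite}"
  shows "x ^ card (UNIV :: 'a set) = x"
proof (cases "x = 0")
  case False
  have "(\<Prod>y\<in>UNIV-{0}. x * y) = (\<Prod>y\<in>UNIV-{0}. y)"
    by (rule prod.reindex_bij_witness[of _ "\<lambda>y. y / x" "\<lambda>y. x * y"]) (use False in auto)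
  then have "x ^ (card (UNIV :: 'a set) - 1) = 1"
    by (simp add: prod.distrib)
  then have "x ^ Suc (card (UNIV :: 'a set) - 1) = x"
    by simp
  then show ?thesis
    using finite_UNIV_card_ge_0[where ?'a = 'a] by simp
qed (use finite_UNIV_card_ge_0[where ?'a = 'a] in auto)

text \<open>Translation by 1 permutes the ring and leaves the sum of all elements unchanged. For a
  field of order \<open>2 ^ m\<close> this yields characteristic 2.\<close>

lemma of_nat_card_finite_ring: "of_nat (card (UNIV :: 'a::{comm_ring_1, finite} set)) = (0 :: 'a)"
proof -
  have "(\<Sum>x\<in>UNIV. x + 1) = (\<Sum>x\<in>UNIV. x :: 'a)"
    by (rule sum.reindex_bij_witness[of _ "\<lambda>x. x - 1" "\<lambda>x. x + 1"]) auto
  then show ?thesis by (simp add: sum.distrib)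
qed

text \<open>The polynomial \<open>X^q - X\<close> has at most \<open>q\<close> roots, and the
  embedded field already supplies \<open>q\<close> of them.\<close>

lemma frobenius_fixed_in_range_to_ac:
  fixes z :: "'a::{field, finite} alg_closure"
  assumes "z ^ card (UNIV :: 'a set) = z"
  shows "z \<in> range to_ac"
proof -
  define q where "q = card (UNIV :: 'a set)"
  define p :: "'a alg_closure poly" where "p = monom 1 q - monom 1 1"
  have "q > 1"
    using card_mono[of "UNIV :: 'a set" "{0, 1}"] by (simp add: q_def)
  have deg: "degree p = q"
    unfolding p_def diff_conv_add_uminus using \<open>q > 1\<close>
    by (subst degree_add_eq_left) (auto simp: degree_monom_eq)
  have p0: "p \<noteq> 0" using deg \<open>q > 1\<close> by auto
  have "range to_ac \<subseteq> {x. poly p x = 0}"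
  proof safe
    fix x :: 'a
    show "poly p (to_ac x) = 0"
      by (simp add: p_def poly_monom q_def finite_type_power_card flip: to_ac_power)
  qed
  moreover have "card (range (to_ac :: 'a \<Rightarrow> _)) = q"
    by (simp add: card_image inj_to_ac q_def)
  moreover have "card {x. poly p x = 0} \<le> q"
    using card_poly_roots_bound[OF p0] deg by simp
  ultimately have "range to_ac = {x. poly p x = 0}"
    using poly_roots_finite[OF p0] by (metis card_seteq)
  moreover have "poly p z = 0"
    using assms by (simp add: p_def poly_monom q_def)
  ultimately show ?thesis by blast
qed

lemma poly_to_ac_add:
  "poly (map_poly to_ac (p + q)) x = poly (map_poly to_ac p) x + poly (map_poly to_ac q) x"
  by (induction p q rule: poly_induct2) (auto simp: map_poly_pCons algebra_simps)

lemma poly_to_ac_smult: "poly (map_poly to_ac (smult c p)) x = to_ac c * poly (map_poly to_ac p) x"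
  by (induction p) (auto simp: map_poly_pCons algebra_simps)

lemma poly_to_ac_mult:
  "poly (map_poly to_ac (p * q)) x = poly (map_poly to_ac p) x * poly (map_poly to_ac q) x"
  by (induction p) (auto simp: map_poly_pCons poly_to_ac_add poly_to_ac_smult algebra_simps)

lemma poly_to_ac_pcompose:
  "poly (map_poly to_ac (pcompose p q)) x = poly (map_poly to_ac p) (poly (map_poly to_ac q) x)"
  by (induction p)
    (auto simp: pcompose_pCons map_poly_pCons poly_to_ac_add poly_to_ac_mult)

lemma poly_to_ac_poly_iterate:
  "poly (map_poly to_ac (poly_iterate n p)) x = ((\<lambda>y. poly (map_poly to_ac p) y) ^^ n) x"
proof (induction n)
  case 0
  show ?case by (simp add: poly_iterate_def map_poly_pCons)
next
  case (Suc n)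
  then show ?case by (simp add: poly_iterate_def poly_to_ac_pcompose)
qed

lemma poly_to_ac_frobenius:
  fixes p :: "'a::{field, finite} poly"
  assumes "card (UNIV :: 'a set) = 2 ^ m" "(2 :: 'a alg_closure) = 0"
  shows "poly (map_poly to_ac p) (x ^ 2 ^ m) = poly (map_poly to_ac p) x ^ 2 ^ m"
proof (induction p)
  case (pCons c p)
  have "to_ac c ^ 2 ^ m = to_ac c"
    using finite_type_power_card[of c] assms(1) by (simp flip: to_ac_power)
  with pCons show ?case
    by (simp add: map_poly_pCons add_power_two_power[OF assms(2)] power_mult_distrib)
qed (simp add: power_0_left)

text \<open>The Frobenius conjugates of \<open>\<xi>\<close> are all roots of \<open>A\<close>, so
  two of the first \<open>degree A + 1\<close> coincide. Injectivity of Frobenius cancels the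
  smaller exponent.\<close>

lemma frobenius_period_of_root:
  fixes A :: "'a::{field, finite} poly"
  assumes card: "card (UNIV :: 'a set) = 2 ^ m" and two: "(2 :: 'a alg_closure) = 0"
    and A: "A \<noteq> 0" "poly (map_poly to_ac A) \<xi> = 0"
  obtains j where "0 < j" "j \<le> degree A" "\<xi> ^ ((2 ^ m) ^ j) = \<xi>"
proof -
  let ?q = "(2::nat) ^ m" and ?B = "map_poly to_ac A"
  have B0: "?B \<noteq> 0" using A(1) by (simp add: map_poly_eq_0_iff)
  have degB: "degree ?B = degree A" by (simp add: degree_map_poly)
  have root: "poly ?B (\<xi> ^ (?q ^ i)) = 0" for i
  proof (induction i)
    case (Suc i)
    have "\<xi> ^ (?q ^ Suc i) = (\<xi> ^ (?q ^ i)) ^ ?q" by (simp add: mult.commute flip: power_mult)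
    with Suc show ?case by (simp add: poly_to_ac_frobenius[OF card two] power_0_left)
  qed (use A in simp)
  have "\<not> inj_on (\<lambda>i. \<xi> ^ (?q ^ i)) {..degree A}"
  proof
    assume "inj_on (\<lambda>i. \<xi> ^ (?q ^ i)) {..degree A}"
    then have "Suc (degree A) \<le> card {x. poly ?B x = 0}"
      using card_inj_on_le[of _ "{..degree A}" "{x. poly ?B x = 0}"] root poly_roots_finite[OF B0]
      by auto
    then show False using card_poly_roots_bound[OF B0] degB by simp
  qed
  then obtain i k where ik: "i < k" "k \<le> degree A" "\<xi> ^ (?q ^ i) = \<xi> ^ (?q ^ k)"
    unfolding inj_on_def by (metis atMost_iff linorder_neqE_nat)
  have "(\<xi> ^ (?q ^ (k - i)) - \<xi>) ^ (?q ^ i) = 0"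
  proof -
    let ?y = "\<xi> ^ (?q ^ (k - i))"
    have "?q ^ k = ?q ^ (k - i) * ?q ^ i" using ik(1) by (simp flip: power_add)
    then have "?y ^ (?q ^ i) = \<xi> ^ (?q ^ i)" using ik(3) by (simp add: power_mult)
    \<comment> \<open>Writing \<open>?y\<close> as a sum lets additivity of Frobenius give the power
      of the difference.\<close>
    moreover have "(?y - \<xi> + \<xi>) ^ 2 ^ (m * i) = (?y - \<xi>) ^ 2 ^ (m * i) + \<xi> ^ 2 ^ (m * i)"
      by (rule add_power_two_power[OF two])
    ultimately show ?thesis by (simp add: power_mult)
  qed
  then have "\<xi> ^ (?q ^ (k - i)) = \<xi>" by simp
  with ik show ?thesis by (intro that[of "k - i"]) auto
qed

section \<open>Irreducibility by factor degrees, and the theorem\<close>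

lemma funpow_conjugate:
  assumes "\<And>x. h (f x) = g (h x)"
  shows "h ((f ^^ n) x) = (g ^^ n) (h x)"
  by (induction n) (auto simp: assms)

lemma degree_poly_iterate: "degree (poly_iterate n (t :: 'a::idom poly)) = degree t ^ n"
  by (induction n) (auto simp: poly_iterate_def degree_pcompose)

lemma irreducible_if_factor_degrees_ge:
  fixes P :: "'a::field poly"
  assumes "degree P > 0" "\<And>A. A dvd P \<Longrightarrow> degree A > 0 \<Longrightarrow> degree P \<le> degree A"
  shows "irreducible P"
proof (rule irreducibleI)
  show "P \<noteq> 0" using assms(1) by auto
  then show "\<not> is_unit P" using assms(1) by (simp add: is_unit_iff_degree)
next
  fix A B assume AB: "P = A * B"
  then have nz: "A \<noteq> 0" "B \<noteq> 0" using assms(1) by auto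
  then have "degree P = degree A + degree B" by (simp add: AB degree_mult_eq)
  moreover have "degree A > 0 \<Longrightarrow> degree P \<le> degree A" using assms(2)[of A] AB by simp
  ultimately have "degree A = 0 \<or> degree B = 0" by linarith
  then show "is_unit A \<or> is_unit B" using nz by (auto simp: is_unit_iff_degree)
qed

lemma irreducible_no_root:
  fixes p :: "'a::field poly"
  assumes "irreducible p" "degree p > 1"
  shows "poly p x \<noteq> 0"
proof
  assume "poly p x = 0"
  then obtain r where r: "p = [:-x, 1:] * r" by (auto simp: poly_eq_0_iff_dvd)
  then have "r \<noteq> 0" using assms by auto
  then have "degree p = 1 + degree r" by (simp add: r degree_mult_eq del: mult_pCons_left)
  moreover have "is_unit [:-x, 1:] \<or> is_unit r"
    using assms(1) r by (metis irreducibleD)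
  ultimately show False using assms(2) \<open>r \<noteq> 0\<close> by (auto simp: is_unit_iff_degree)
qed

theorem theorem4p4:
  fixes a b :: "'a::{field, finite}" and m :: nat
  assumes "m \<ge> 1"
    and "card (UNIV :: 'a set) = 2 ^ m"
    and "a \<noteq> 0" and "b \<noteq> 0"
    and "Tr m (inverse (a * b)) = Tr m (1 :: 'a)"
  shows "stable_poly (smult (b ^ 2) ([:a, 1:] ^ 3) + [:0, 1:])
    \<longleftrightarrow> irreducible (smult (b ^ 2) ([:a, 1:] ^ 3) + [:0, 1:])"
    (is "stable_poly ?f \<longleftrightarrow> irreducible ?f")
proof
  assume "stable_poly ?f"
  then have "irreducible (poly_iterate 1 ?f)" by (auto simp: stable_poly_def)
  then show "irreducible ?f" by (simp add: poly_iterate_def pcompose_idR)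
next
  assume irr: "irreducible ?f"
  let ?h = "to_ac :: 'a \<Rightarrow> _"
  define q where "q = (2::nat) ^ m"
  have "(2::'a) ^ m = of_nat (card (UNIV :: 'a set))" by (simp add: assms(2))
  also have "\<dots> = 0"
    by (rule of_nat_card_finite_ring)
  finally have two': "(2::'a) = 0" by simp
  then have two: "(2::'a alg_closure) = 0" by (metis to_ac_0 to_ac_numeral)
  have deg: "degree ?f = 3"
    using assms(4) by (subst degree_add_eq_left) (auto simp: degree_power_eq)
  have fixed: "?h x ^ q = ?h x" for x
    using finite_type_power_card[of x] assms(2) by (simp add: q_def flip: to_ac_power)
  define c where "c = a * b"
  define \<phi> where "\<phi> x = ?h b * (x + ?h a)" for x
  have conj: "\<phi> (poly (map_poly to_ac ?f) x) = (\<phi> x) ^ 3 + \<phi> x" for x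
    by (simp add: \<phi>_def poly_to_ac_add poly_to_ac_smult poly_to_ac_mult map_poly_pCons
        power3_eq_cube power2_eq_square algebra_simps)
  have no_root: "z ^ 3 + z \<noteq> ?h c" if "z ^ q = z" for z
  proof
    assume z: "z ^ 3 + z = ?h c"
    obtain y where y: "z = ?h y"
      using frobenius_fixed_in_range_to_ac[of z] \<open>z ^ q = z\<close> assms(2) by (auto simp: q_def)
    have "?h (y ^ 3 + y) = ?h c" using z by (simp add: y)
    then have yc: "y ^ 3 + y = a * b" unfolding to_ac_eq_iff c_def .
    \<comment> \<open>The point \<open>y / b - a\<close> is the preimage of \<open>y\<close> under
      the substitution \<open>\<phi>\<close>.\<close>
    have "b * poly ?f (y / b - a) = y ^ 3 + y - a * b"
      using assms(4) by (simp add: field_simps power3_eq_cube power2_eq_square)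
    then have "poly ?f (y / b - a) = 0" using yc assms(4) by (simp del: poly_add)
    moreover have "degree ?f > 1" unfolding deg by simp
    ultimately show False using irreducible_no_root[OF irr] by blast
  qed
  have tr: "Tr m (inverse (?h c)) = Tr m 1"
  proof -
    have "Tr m (?h x) = ?h (Tr m x)" for x by (simp add: Tr_def to_ac_sum)
    then show ?thesis using assms(5) by (metis c_def to_ac_1 to_ac_inverse)
  qed
  have c0: "?h c \<noteq> 0" using assms by (simp add: c_def)
  have "irreducible (poly_iterate n ?f)" for n
  proof (rule irreducible_if_factor_degrees_ge)
    show "degree (poly_iterate n ?f) > 0" unfolding degree_poly_iterate deg by simp
  next
    fix A assume A: "A dvd poly_iterate n ?f" "degree A > 0"
    then have "A \<noteq> 0" by auto
    obtain \<xi> where \<xi>: "poly (map_poly to_ac A) \<xi> = 0"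
      using alg_closed_imp_poly_has_root[of "map_poly to_ac A"] A by (auto simp: degree_map_poly)
    obtain j where j: "0 < j" "j \<le> degree A" "\<xi> ^ (q ^ j) = \<xi>"
      using frobenius_period_of_root[OF assms(2) two \<open>A \<noteq> 0\<close> \<xi>] by (auto simp: q_def)
    have "poly (map_poly to_ac (poly_iterate n ?f)) \<xi> = 0"
      using A(1) \<xi> by (auto simp: poly_to_ac_mult)
    then have "((\<lambda>x. poly (map_poly to_ac ?f) x) ^^ n) \<xi> = 0"
      by (simp only: poly_to_ac_poly_iterate)
    \<comment> \<open>Conjugation carries the root condition to the value \<open>\<phi> 0\<close>,
      which is the image of \<open>a * b\<close>, not 0.\<close>
    then have "((\<lambda>z. z ^ 3 + z) ^^ n) (\<phi> \<xi>) = \<phi> 0"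
      using funpow_conjugate[where h = \<phi> and f = "poly (map_poly to_ac ?f)"
          and g = "\<lambda>z. z ^ 3 + z" and n = n and x = \<xi>, OF conj] by simp
    then have 1: "((\<lambda>z. z ^ 3 + z) ^^ n) (\<phi> \<xi>) = ?h c"
      by (simp add: \<phi>_def c_def mult.commute)
    have fixed': "?h x ^ (q ^ j) = ?h x" for x
      by (induction j) (simp_all add: power_mult fixed)
    have "q ^ j = 2 ^ (m * j)" by (simp add: q_def power_mult)
    \<comment> \<open>The coefficients of \<open>\<phi>\<close> lie in the base field, so
      \<open>\<phi>\<close> commutes with the \<open>q ^ j\<close>-Frobenius.\<close>
    then have 2: "\<phi> \<xi> ^ (q ^ j) = \<phi> \<xi>"
      using add_power_two_power[OF two] fixed' j(3)
      by (simp add: \<phi>_def power_mult_distrib)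
    have "3 ^ n dvd j"
      using three_power_dvd_period_of_iterate_root[OF two q_def c0 fixed tr no_root 1 2] .
    then show "degree (poly_iterate n ?f) \<le> degree A"
      using j dvd_imp_le[of "3 ^ n" j] unfolding degree_poly_iterate deg by simp
  qed
  then show "stable_poly ?f" by (simp add: stable_poly_def)
qed

end
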